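(* Let $k\ge 1$ and $r\ge 0$. Let $\mathbb{A}$ and $\mathbb{B}$ be two order $k+1$ complex tensors with dimension $n$ and $m$, respectively. Let $\mathbb{C}$ and $\mathbb{D}$ be two order $r+1$ complex tensors with dimension $n$ and $m$, respectively. Then $$(\mathbb{A}\otimes\mathbb{B})(\mathbb{C}\otimes\mathbb{D})=(\mathbb{A}\mathbb{C})\otimes(\mathbb{B}\mathbb{D}).$$
   Context: Write $[n]=\{1,\dots,n\}$. An order $p$ dimension $n$ tensor is an array of complex numbers indexed by $[n]^p$. General tensor product: if $\mathbb{A}$ has order $p\ge 2$ and $\mathbb{B}$ has order $q\ge 1$, both of dimension $n$, then $\mathbb{A}\mathbb{B}$ is the tensor of order $(p-1)(q-1)+1$ and dimension $n$ with entries $$(\mathbb{A}\mathbb{B})_{i\alpha_1\cdots\alpha_{p-1}}=\sum_{i_2,\dots,i_p=1}^n a_{ii_2\cdots i_p}\,b_{i_2\alpha_1}\cdots b_{i_p\alpha_{p-1}}\qquad(i\in[n],\ \alpha_1,\dots,\alpha_{p-1}\in[n]^{q-1}),$$ subscripts being concatenated. The same definition applies with $[n]$ replaced by any finite ordered index set. Direct product: if $\mathbb{A}$ and $\mathbb{B}$ are tensors of the same order $p$ with dimensions $n$ and $m$ respectively, $\mathbb{A}\otimes\mathbb{B}$ is the tensor of order $p$ and dimension $nm$, with index set $[n]\times[m]$ in lexicographic order, given by $$(\mathbb{A}\otimes\mathbb{B})_{(i_1,j_1)\cdots(i_p,j_p)}=a_{i_1\cdots i_p}b_{j_1\cdots j_p}.$$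 *)

theory Defs
  imports Complex_Main "HOL-Library.FuncSet"
begin

text \<open>
  A tensor carries its order, its finite ordered index set (a list without repetitions) and its
  array of entries. Multi-indices are lists; entries are extensional, i.e. \<open>undefined\<close> away
  from the multi-indices of the tensor, so that equality of tensors is HOL equality.
\<close>

record 'i tensor =
  ord :: nat
  idx :: "'i list"
  entry :: "'i list \<Rightarrow> complex"

definition multi_indices :: "nat \<Rightarrow> 'i list \<Rightarrow> 'i list set" where
  "multi_indices p I = {xs. length xs = p \<and> set xs \<subseteq> set I}"

definition is_tensor :: "nat \<Rightarrow> 'i list \<Rightarrow> 'i tensor \<Rightarrow> bool" where
  "is_tensor p I A \<longleftrightarrow>
     distinct I \<and> ord A = p \<and> idx A = I \<and> entry A \<in> extensional (multi_indices p I)"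

abbreviation is_tensor_dim :: "nat \<Rightarrow> nat \<Rightarrow> nat tensor \<Rightarrow> bool" where
  "is_tensor_dim p n \<equiv> is_tensor p [1..<n + 1]"

text \<open>The \<open>j\<close>-th (from 0) consecutive block of length \<open>r\<close> of a concatenated subscript.\<close>

definition block :: "nat \<Rightarrow> nat \<Rightarrow> 'i list \<Rightarrow> 'i list" where
  "block r j xs = take r (drop (j * r) xs)"

text \<open>
  Only meaningful if both factors have the same index set, the first has order at least 2 and
  the second order at least 1. The summation variable \<open>js\<close> is the tuple
  \<open>i\<^sub>2, \<dots>, i\<^sub>p\<close>; the head of a multi-index is \<open>i\<close>, its tail the
  concatenation of \<open>\<alpha>\<^sub>1, \<dots>, \<alpha>\<^bsub>p-1\<^esub>\<close>.
\<close>

definition tensor_prod :: "'i tensor \<Rightarrow> 'i tensor \<Rightarrow> 'i tensor"  (infixl "\<bullet>" 70) where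
  "A \<bullet> B =
     (let p = ord A; q = ord B; I = idx A; s = (p - 1) * (q - 1) + 1 in
      \<lparr>ord = s, idx = I,
       entry = (\<lambda>xs\<in>multi_indices s I.
         \<Sum>js\<in>multi_indices (p - 1) I.
           entry A (hd xs # js) * (\<Prod>j<p - 1. entry B (js ! j # block (q - 1) j (tl xs))))\<rparr>)"

text \<open>
  Only meaningful if both factors have the same order. \<^const>\<open>List.product\<close> enumerates
  the pairs lexicographically.
\<close>

definition direct_prod :: "'i tensor \<Rightarrow> 'j tensor \<Rightarrow> ('i \<times> 'j) tensor"  (infixl "\<otimes>" 75) where
  "A \<otimes> B =
     (let p = ord A; K = List.product (idx A) (idx B) in
      \<lparr>ord = p, idx = K,
       entry = (\<lambda>xs\<in>multi_indices p K. entry A (map fst xs) * entry B (map snd xs))\<rparr>)"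

lemma is_tensor_tensor_prod:
  assumes "is_tensor p I A" and "is_tensor q I B"
  shows "is_tensor ((p - 1) * (q - 1) + 1) I (A \<bullet> B)"
  using assms by (auto simp: is_tensor_def tensor_prod_def Let_def)

lemma is_tensor_direct_prod:
  assumes "is_tensor p I A" and "is_tensor p J B"
  shows "is_tensor p (List.product I J) (A \<otimes> B)"
  using assms by (auto simp: is_tensor_def direct_prod_def Let_def distinct_product)

lemma block_concat:
  assumes "\<forall>\<alpha>\<in>set \<alpha>s. length \<alpha> = r" and "j < length \<alpha>s"
  shows "block r j (concat \<alpha>s) = \<alpha>s ! j"
  using assms
proof (induction \<alpha>s arbitrary: j)
  case (Cons \<alpha> \<alpha>s)
  then show ?case by (cases j) (auto simp: block_def)
qed simp

lemma length_concat_const: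
  assumes "\<forall>\<alpha>\<in>set \<alpha>s. length \<alpha> = r"
  shows "length (concat \<alpha>s) = length \<alpha>s * r"
  using assms by (induction \<alpha>s) auto

text \<open>The entries of the general product with the subscripts written as in its usual definition.\<close>

lemma entry_tensor_prod_concat:
  assumes "is_tensor p I A" and "is_tensor q I B"
    and "i \<in> set I" and "length \<alpha>s = p - 1" and "set \<alpha>s \<subseteq> multi_indices (q - 1) I"
  shows "entry (A \<bullet> B) (i # concat \<alpha>s) =
    (\<Sum>js\<in>multi_indices (p - 1) I.
       entry A (i # js) * (\<Prod>j<p - 1. entry B (js ! j # \<alpha>s ! j)))"
proof -
  have len: "\<forall>\<alpha>\<in>set \<alpha>s. length \<alpha> = q - 1"
    using assms(5) by (auto simp: multi_indices_def)
  have "i # concat \<alpha>s \<in> multi_indices ((p - 1) * (q - 1) + 1) I"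
    using assms(3-5) length_concat_const[OF len] by (auto simp: multi_indices_def)
  then show ?thesis
    using assms(1,2,4) block_concat[OF len]
    by (auto simp: tensor_prod_def Let_def is_tensor_def intro!: sum.cong)
qed

end

theory Submission
  imports Defs
begin

text \<open>An entry of the left side is a sum over k-tuples of pairs. By the definition of the
  direct product, each factor of a summand is an entry at the first coordinates times an entry at
  the second ones. Collecting these, the summand becomes a term in \<open>A\<close> and
  \<open>C\<close> times a term in \<open>B\<close> and \<open>D\<close>. A tuple of pairs is the
  same as a pair of tuples (\<open>bij_betw_multi_indices_product\<close>), so the sum is a double
  sum of such products and factors into an entry of \<open>A \<bullet> C\<close> times an entry of
  \<open>B \<bullet> D\<close>. The subscripts match because cutting into blocks commutes with
  projecting (\<open>block_map\<close>).\<close>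

lemma Cons_in_multi_indices:
  "x # xs \<in> multi_indices (Suc p) I \<longleftrightarrow> x \<in> set I \<and> xs \<in> multi_indices p I"
  by (auto simp: multi_indices_def)

lemma nth_in_multi_indices:
  "xs \<in> multi_indices p I \<Longrightarrow> j < p \<Longrightarrow> xs ! j \<in> set I"
  by (auto simp: multi_indices_def)

lemma map_fst_in_multi_indices:
  "xs \<in> multi_indices p (List.product I J) \<Longrightarrow> map fst xs \<in> multi_indices p I"
  by (force simp: multi_indices_def)

lemma map_snd_in_multi_indices:
  "xs \<in> multi_indices p (List.product I J) \<Longrightarrow> map snd xs \<in> multi_indices p J"
  by (force simp: multi_indices_def)

text \<open>Unzipping is inverted by \<open>zip\<close>, which loses nothing because both lists have
  length \<open>p\<close>.\<close>

lemma bij_betw_multi_indices_product: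
  "bij_betw (\<lambda>xs. (map fst xs, map snd xs))
     (multi_indices p (List.product I J)) (multi_indices p I \<times> multi_indices p J)"
  by (rule bij_betw_byWitness[where f' = "\<lambda>(us, vs). zip us vs"])
    (auto simp: zip_map_fst_snd map_fst_in_multi_indices map_snd_in_multi_indices,
      auto simp: multi_indices_def dest: set_zip_leftD set_zip_rightD)

lemma block_map: "block r j (map f xs) = map f (block r j xs)"
  by (simp add: block_def take_map drop_map)

lemma block_in_multi_indices:
  assumes "xs \<in> multi_indices (k * r) I" and "j < k"
  shows "block r j xs \<in> multi_indices r I"
proof -
  \<comment> \<open>The block ends at position \<open>Suc j * r\<close>; within the list,
    \<open>take\<close> yields all \<open>r\<close> letters.\<close>
  have "Suc j * r \<le> k * r"
    using assms(2) by (intro mult_le_mono1) simp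
  then show ?thesis
    using assms(1) by (auto simp: multi_indices_def block_def dest: in_set_takeD in_set_dropD)
qed

lemma entry_direct_prod:
  assumes "is_tensor p I A" and "is_tensor p J B" and "xs \<in> multi_indices p (List.product I J)"
  shows "entry (A \<otimes> B) xs = entry A (map fst xs) * entry B (map snd xs)"
  using assms by (simp add: direct_prod_def is_tensor_def Let_def)

text \<open>Orders written as successors free the formula of truncated subtraction.\<close>

lemma entry_tensor_prod:
  assumes "is_tensor (k + 1) I A" and "is_tensor (r + 1) I C"
    and "x # xs \<in> multi_indices (k * r + 1) I"
  shows "entry (A \<bullet> C) (x # xs) =
    (\<Sum>js\<in>multi_indices k I. entry A (x # js) * (\<Prod>j<k. entry C (js ! j # block r j xs)))"
  using assms by (simp add: tensor_prod_def is_tensor_def Let_def)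

text \<open>Entries are extensional, so agreement on the multi-indices makes them equal as
  functions.\<close>

lemma tensor_eqI:
  fixes S T :: "'i tensor"
  assumes "is_tensor p I S" and "is_tensor p I T"
    and "\<And>xs. xs \<in> multi_indices p I \<Longrightarrow> entry S xs = entry T xs"
  shows "S = T"
proof -
  have "entry S = entry T"
    using assms by (auto simp: is_tensor_def intro: extensionalityI)
  then show ?thesis
    using assms(1,2) by (simp add: is_tensor_def)
qed

lemma tensor_prod_direct_prod:
  assumes A: "is_tensor (k + 1) I A" and B: "is_tensor (k + 1) J B"
    and C: "is_tensor (r + 1) I C" and D: "is_tensor (r + 1) J D"
  shows "(A \<otimes> B) \<bullet> (C \<otimes> D) = (A \<bullet> C) \<otimes> (B \<bullet> D)"
proof (rule tensor_eqI)
  let ?K = "List.product I J"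
  note AB = is_tensor_direct_prod[OF A B] and CD = is_tensor_direct_prod[OF C D]
  have AC: "is_tensor (k * r + 1) I (A \<bullet> C)" and BD: "is_tensor (k * r + 1) J (B \<bullet> D)"
    using is_tensor_tensor_prod[OF A C] is_tensor_tensor_prod[OF B D] by simp_all
  show "is_tensor (k * r + 1) ?K ((A \<otimes> B) \<bullet> (C \<otimes> D))"
    using is_tensor_tensor_prod[OF AB CD] by simp
  show "is_tensor (k * r + 1) ?K ((A \<bullet> C) \<otimes> (B \<bullet> D))"
    using is_tensor_direct_prod[OF AC BD] .
  fix zs assume zs: "zs \<in> multi_indices (k * r + 1) ?K"
  then obtain x y xs where zs_eq: "zs = (x, y) # xs"
    by (cases zs) (auto simp: multi_indices_def)
  have xy: "(x, y) \<in> set ?K" and xs: "xs \<in> multi_indices (k * r) ?K"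
    using zs by (simp_all add: zs_eq Cons_in_multi_indices)
  \<comment> \<open>\<open>F\<close> and \<open>G\<close> are the summands of
    \<open>A \<bullet> C\<close> and \<open>B \<bullet> D\<close> at the two projections of
    \<open>zs\<close>.\<close>
  define F where
    "F us = entry A (x # us) * (\<Prod>j<k. entry C (us ! j # block r j (map fst xs)))" for us
  define G where
    "G vs = entry B (y # vs) * (\<Prod>j<k. entry D (vs ! j # block r j (map snd xs)))" for vs
  have summand: "entry (A \<otimes> B) ((x, y) # js) *
      (\<Prod>j<k. entry (C \<otimes> D) (js ! j # block r j xs)) = F (map fst js) * G (map snd js)"
    if js: "js \<in> multi_indices k ?K" for js
  proof -
    have "entry (A \<otimes> B) ((x, y) # js) = entry A (x # map fst js) * entry B (y # map snd js)"
      using xy js by (subst entry_direct_prod[OF A B]) (simp_all add: Cons_in_multi_indices)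
    moreover have "entry (C \<otimes> D) (js ! j # block r j xs) =
        entry C (map fst js ! j # block r j (map fst xs)) *
        entry D (map snd js ! j # block r j (map snd xs))" if "j < k" for j
    proof -
      have "js ! j # block r j xs \<in> multi_indices (r + 1) ?K"
        using nth_in_multi_indices[OF js that] block_in_multi_indices[OF xs that]
        by (simp add: Cons_in_multi_indices del: set_product)
      \<comment> \<open>The bound \<open>j < length js\<close> lets \<open>map fst js ! j\<close>
        become \<open>fst (js ! j)\<close>, and likewise for \<open>snd\<close>.\<close>
      moreover have "length js = k"
        using js by (simp add: multi_indices_def)
      ultimately show ?thesis
        using that by (simp add: entry_direct_prod[OF C D] block_map)
    qed
    ultimately show ?thesis
      by (simp add: F_def G_def prod.distrib)
  qed
  have "entry ((A \<otimes> B) \<bullet> (C \<otimes> D)) zs =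
      (\<Sum>js\<in>multi_indices k ?K. F (map fst js) * G (map snd js))"
    using entry_tensor_prod[OF AB CD zs[unfolded zs_eq]] summand by (simp add: zs_eq)
  \<comment> \<open>Here \<open>us\<close> and \<open>vs\<close> become independent, so that
    distributivity can split the sum.\<close>
  also have "\<dots> = (\<Sum>(us, vs)\<in>multi_indices k I \<times> multi_indices k J. F us * G vs)"
    using sum.reindex_bij_betw[OF bij_betw_multi_indices_product, of "\<lambda>(us, vs). F us * G vs"]
    by simp
  also have "\<dots> = (\<Sum>us\<in>multi_indices k I. F us) * (\<Sum>vs\<in>multi_indices k J. G vs)"
    by (simp add: sum_product sum.cartesian_product)
  also have "\<dots> = entry (A \<bullet> C) (map fst zs) * entry (B \<bullet> D) (map snd zs)"
    using map_fst_in_multi_indices[OF zs] map_snd_in_multi_indices[OF zs]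
    by (simp add: zs_eq F_def G_def entry_tensor_prod[OF A C] entry_tensor_prod[OF B D])
  also have "\<dots> = entry ((A \<bullet> C) \<otimes> (B \<bullet> D)) zs"
    using entry_direct_prod[OF AC BD zs] by simp
  finally show "entry ((A \<otimes> B) \<bullet> (C \<otimes> D)) zs = entry ((A \<bullet> C) \<otimes> (B \<bullet> D)) zs" .
qed

theorem theorem3p1:
  fixes k r n m :: nat
    and A B C D :: "nat tensor"
  assumes "k \<ge> 1" and "r \<ge> 0"
    and "is_tensor_dim (k + 1) n A" and "is_tensor_dim (k + 1) m B"
    and "is_tensor_dim (r + 1) n C" and "is_tensor_dim (r + 1) m D"
  shows "(A \<otimes> B) \<bullet> (C \<otimes> D) = (A \<bullet> C) \<otimes> (B \<bullet> D)"
  using assms(3-6) by (rule tensor_prod_direct_prod)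

end
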